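(* Let $\gamma_0 := 2+\log 4$, let $\gamma_0 < \gamma \le 4$, and put $\delta := (\gamma-\gamma_0)/8$. Then for every integer $n\ge 1$ and every $f \in \mathcal{T}_n$, $$|f(0)| \le \gamma^{1/2}\left(1+\delta^{-2}e^{-\delta\gamma n}\right)^{1/2}\, n\, \|f\|_{L_2[0,1]}.$$
   Context: For an integer $n\ge1$, $\mathcal{T}_n$ denotes the set of all functions $f:\mathbb{R}\to\mathbb{C}$ of the form $f(t)=\sum_{j=1}^n a_j e^{i\lambda_j t}$ with $a_j\in\mathbb{C}$ (possibly zero) and real exponents $\lambda_1<\lambda_2<\cdots<\lambda_n$. $\|f\|_{L_2[0,1]} = (\int_0^1 |f(t)|^2\,dt)^{1/2}$. *)

theory Defs
  imports "HOL-Analysis.Analysis"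
begin

definition exp_sums :: "nat \<Rightarrow> (real \<Rightarrow> complex) set" where
  "exp_sums n = {f. \<exists>(a::nat \<Rightarrow> complex) (lam::nat \<Rightarrow> real).
      (\<forall>j k. 1 \<le> j \<longrightarrow> j < k \<longrightarrow> k \<le> n \<longrightarrow> lam j < lam k) \<and>
      (\<forall>t. f t = (\<Sum>j=1..n. a j * exp (\<i> * complex_of_real (lam j * t))))}"

definition L2_01_norm :: "(real \<Rightarrow> complex) \<Rightarrow> real" where
  "L2_01_norm f = sqrt (integral {0..1} (\<lambda>t. (cmod (f t))^2))"

end

theory Submission
  imports Defs "HOL-Real_Asymp.Real_Asymp"
begin

text \<open>
  On the half line there is a sharp estimate: if all exponents of an \<open>n\<close>-term sum \<open>h\<close> have real part
  \<open>-\<alpha>/2\<close>, then \<open>|h(0)|\<^sup>2 \<le> n \<alpha> \<integral> |h|\<^sup>2\<close> over \<open>[0,\<infinity>)\<close>. We apply it to \<open>h(t) = exp(-\<alpha>t/2) f(t)\<close> with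
  \<open>\<alpha> = \<gamma>n\<close>. On \<open>[0,1]\<close> the weight is at most 1. Beyond 1 we cut the line into blocks of length \<open>1/n\<close>:
  a recurrence of Turan type bounds \<open>|f|\<^sup>2\<close> on the \<open>N\<close>-th block by \<open>4^(n+N)\<close> times its values on
  the first \<open>n\<close> blocks, and the weight \<open>exp(-\<gamma>N)\<close> turns this into a geometric series of size
  \<open>(16 exp(-\<gamma>))^n\<close>, which is smaller than needed because \<open>16 < 4 e\<^sup>2 = exp \<gamma>\<^sub>0\<close>.
\<close>

section \<open>Power sums with nodes on the unit circle, and integrals cut into blocks\<close>

text \<open>Induction on the number of terms: \<open>g(k+1) - z\<^sub>w g(k)\<close> has one term fewer and is at most \<open>2A\<close> on
  its initial window.\<close>
lemma power_sum_growth: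
  fixes a z :: "'a \<Rightarrow> complex"
  assumes "finite S" "\<And>j. j \<in> S \<Longrightarrow> cmod (z j) = 1" "A \<ge> 0"
    and "\<And>k. k < card S \<Longrightarrow> cmod (\<Sum>j\<in>S. a j * z j ^ k) \<le> A"
  shows "cmod (\<Sum>j\<in>S. a j * z j ^ N) \<le> A * 2 ^ (card S + N)"
  using assms
proof (induction S arbitrary: a A N rule: finite_induct)
  case empty
  then show ?case by simp
next
  case (insert w S)
  define g where "g k = (\<Sum>j\<in>insert w S. a j * z j ^ k)" for k
  define u where "u k = (\<Sum>j\<in>S. (a j * (z j - z w)) * z j ^ k)" for k
  have w: "cmod (z w) = 1" and card: "card (insert w S) = Suc (card S)"
    using insert by auto
  have gA: "cmod (g k) \<le> A" if "k \<le> card S" for k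
    using insert.prems(3)[of k] that card by (simp add: g_def)
  have u: "u k = g (Suc k) - z w * g k" for k
    using insert.hyps unfolding u_def g_def
    by (simp add: sum_distrib_left algebra_simps flip: sum_subtractf)
  have "cmod (u k) \<le> 2 * A" if "k < card S" for k
  proof -
    have "cmod (u k) \<le> cmod (g (Suc k)) + cmod (z w * g k)"
      unfolding u by (rule norm_triangle_ineq4)
    then show ?thesis using gA[of k] gA[of "Suc k"] that w by (simp add: norm_mult)
  qed
  then have uA: "cmod (u k) \<le> 2 * A * 2 ^ (card S + k)" for k
    unfolding u_def using insert.prems by (intro insert.IH) auto
  \<comment> \<open>Unrolling \<open>g (Suc k) = u k + z w * g k\<close> with
    \<open>cmod (z w) = 1\<close> adds up the bounds \<open>uA\<close>, a geometric sum of ratio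
    2.\<close>
  have grow: "cmod (g N) \<le> A + 2 * A * 2 ^ card S * (2 ^ N - 1)" for N
  proof (induction N)
    case 0
    then show ?case using gA[of 0] by simp
  next
    case (Suc N)
    have "g (Suc N) = u N + z w * g N" by (simp add: u)
    then have "cmod (g (Suc N)) \<le> cmod (u N) + cmod (g N)"
      using norm_triangle_ineq[of "u N" "z w * g N"] w by (simp add: norm_mult)
    then show ?case using Suc uA[of N] by (simp add: algebra_simps power_add)
  qed
  \<comment> \<open>The \<open>- 1\<close> in \<open>grow\<close> leaves a negative term
    \<open>- A * 2 ^ Suc (card S)\<close>, which pays for the initial \<open>A\<close>.\<close>
  have "A \<le> A * 2 ^ Suc (card S)"
    using mult_left_mono[OF one_le_power[of "2::real" "Suc (card S)"] insert.prems(2)] by simp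
  with grow[of N] have "cmod (g N) \<le> A * 2 ^ (Suc (card S) + N)"
    by (simp add: power_add algebra_simps)
  then show ?case using card by (simp add: g_def)
qed

lemma integral_blocks:
  fixes F :: "real \<Rightarrow> real"
  assumes F: "continuous_on UNIV F" and d: "d \<ge> 0"
  shows "integral {0..real M * d} F = (\<Sum>k<M. integral {0..d} (\<lambda>x. F (x + real k * d)))"
proof (induction M)
  case 0
  then show ?case by simp
next
  case (Suc M)
  have c: "continuous_on S F" for S using F continuous_on_subset by blast
  have "integral {0..real (Suc M) * d} F
      = integral {0..real M * d} F + integral {real M * d..real (Suc M) * d} F"
    using d by (intro Henstock_Kurzweil_Integration.integral_combine[symmetric] integrable_continuous_real c)
      (auto simp: algebra_simps)
  also have "integral {real M * d..real (Suc M) * d} F = integral {0..d} (\<lambda>x. F (x + real M * d))"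
    using integral_shift_Icc_real[of 0 d F "real M * d"]
    by (simp add: algebra_simps o_def)
  finally show ?case using Suc by simp
qed

section \<open>Point evaluation on the half line, removing one exponent at a time\<close>

text \<open>Energy identity of a Blaschke factor: |g - f|^2 has derivative 2 Re m (|g|^2 - |f|^2),
  because the cross terms, m f cnj(g) and its conjugate, enter with opposite signs and have no real
  part left.\<close>

lemma exp_integral_step:
  fixes f g :: "real \<Rightarrow> complex"
  assumes T: "T \<ge> 0"
    and f: "\<And>t. (f has_vector_derivative f' t) (at t)"
    and g: "\<And>t. (g has_vector_derivative g' t) (at t)"
    and ode: "\<And>t. g' t - f' t = cnj m * g t + m * f t"
  shows "(cmod (g 0 - f 0))\<^sup>2 + 2 * Re m * integral {0..T} (\<lambda>t. (cmod (g t))\<^sup>2)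
    = (cmod (g T - f T))\<^sup>2 + 2 * Re m * integral {0..T} (\<lambda>t. (cmod (f t))\<^sup>2)"
proof -
  define D where "D t = 2 * Re m * ((cmod (g t))\<^sup>2 - (cmod (f t))\<^sup>2)" for t
  have cont: "continuous_on X f" "continuous_on X g" for X
    using f g by (meson has_vector_derivative_continuous continuous_at_imp_continuous_on)+
  have "((\<lambda>t. (cmod (g t - f t))\<^sup>2) has_vector_derivative D t) (at t)" for t
  proof -
    have d: "((\<lambda>t. g t - f t) has_vector_derivative (cnj m * g t + m * f t)) (at t)"
      using has_vector_derivative_diff[OF g f] ode by simp
    have *: "((\<lambda>t. inner (g t - f t) (g t - f t)) has_derivative
       (\<lambda>s. inner (g t - f t) (s *\<^sub>R (cnj m * g t + m * f t)) + inner (s *\<^sub>R (cnj m * g t + m * f t)) (g t - f t))) (at t)"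
      using d unfolding has_vector_derivative_def by (intro has_derivative_inner) auto
    have "inner (g t - f t) (s *\<^sub>R (cnj m * g t + m * f t)) + inner (s *\<^sub>R (cnj m * g t + m * f t)) (g t - f t) = s * D t" for s
      unfolding D_def inner_complex_def cmod_power2 by (simp add: algebra_simps power2_eq_square)
    with * show ?thesis by (simp add: has_vector_derivative_def power2_norm_eq_inner)
  qed
  then have "(D has_integral (cmod (g T - f T))\<^sup>2 - (cmod (g 0 - f 0))\<^sup>2) {0..T}"
    using T by (intro fundamental_theorem_of_calculus) (auto intro: has_vector_derivative_at_within)
  then have "integral {0..T} D = (cmod (g T - f T))\<^sup>2 - (cmod (g 0 - f 0))\<^sup>2"
    by (rule integral_unique)
  moreover have "integral {0..T} D = 2 * Re m * (integral {0..T} (\<lambda>t. (cmod (g t))\<^sup>2) - integral {0..T} (\<lambda>t. (cmod (f t))\<^sup>2))"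
    unfolding D_def
    by (subst integral_mult_right, subst integral_diff) (auto intro!: integrable_continuous_real continuous_intros cont)
  ultimately show ?thesis by (simp add: algebra_simps)
qed

text \<open>Cauchy-Schwarz for the vectors (sqrt n, 1) and (sqrt X, sqrt Y). In the induction on the
  exponents it turns the factor \<open>n\<close> into \<open>Suc n\<close>.\<close>

lemma norm_add_sq_le:
  assumes "(norm b)\<^sup>2 \<le> real n * X" "(norm d)\<^sup>2 \<le> Y" "X \<ge> 0"
  shows "(norm (b + d))\<^sup>2 \<le> real (Suc n) * (X + Y)"
proof -
  have "norm b \<le> sqrt n * sqrt X" "norm d \<le> sqrt Y" "Y \<ge> 0"
    using assms order_trans[OF zero_le_power2 assms(2)] by (auto simp: real_le_rsqrt simp flip: real_sqrt_mult)
  then have "norm (b + d) \<le> sqrt n * sqrt X + sqrt Y"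
    using norm_triangle_ineq[of b d] by linarith
  then have "(norm (b + d))\<^sup>2 \<le> (sqrt n * sqrt X + sqrt Y)\<^sup>2"
    by (intro power_mono) auto
  \<comment> \<open>By Lagrange's identity the subtracted square is the exact defect in
    Cauchy-Schwarz.\<close>
  also have "\<dots> \<le> real (Suc n) * (X + Y) - (sqrt n * sqrt Y - sqrt X)\<^sup>2"
    using \<open>X \<ge> 0\<close> \<open>Y \<ge> 0\<close> by (simp add: power2_sum power2_diff power_mult_distrib algebra_simps)
  finally show ?thesis by (smt (verit) zero_le_power2)
qed

lemma exp_sum_has_vector_derivative:
  "((\<lambda>t. \<Sum>j\<in>S. a j * exp (- \<mu> j * complex_of_real t)) has_vector_derivative
    (\<Sum>j\<in>S. - \<mu> j * a j * exp (- \<mu> j * complex_of_real t))) (at t)"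
proof -
  have "((\<lambda>z. \<Sum>j\<in>S. a j * exp (- \<mu> j * z)) has_field_derivative
    (\<Sum>j\<in>S. - \<mu> j * a j * exp (- \<mu> j * complex_of_real t))) (at (complex_of_real t))"
    by (auto intro!: derivative_eq_intros sum.cong)
  from has_vector_derivative_real_field[OF this] show ?thesis .
qed

lemma exp_sum_tendsto_0:
  fixes \<mu> :: "'a \<Rightarrow> complex"
  assumes "\<And>j. j \<in> S \<Longrightarrow> Re (\<mu> j) > 0"
  shows "((\<lambda>t. \<Sum>j\<in>S. a j * exp (- \<mu> j * complex_of_real t)) \<longlongrightarrow> 0) at_top"
proof (rule tendsto_null_sum)
  fix j assume "j \<in> S"
  then have "Re (\<mu> j) > 0" by (rule assms)
  then have "((\<lambda>t. exp (- Re (\<mu> j) * t)) \<longlongrightarrow> 0) at_top"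
    by real_asymp
  then have "((\<lambda>t. cmod (a j) * exp (- Re (\<mu> j) * t)) \<longlongrightarrow> 0) at_top"
    by (rule tendsto_mult_right_zero)
  then show "((\<lambda>t. a j * exp (- \<mu> j * complex_of_real t)) \<longlongrightarrow> 0) at_top"
    by (subst tendsto_norm_zero_iff[symmetric]) (simp add: norm_mult)
qed

text \<open>The function \<open>g\<close> solving \<open>g' - \<mu>\<^sub>w\<^sup>* g = f' + \<mu>\<^sub>w f\<close> corresponds to multiplying the Laplace transform
  of \<open>f\<close> by the Blaschke factor \<open>(s + \<mu>\<^sub>w) / (s - \<mu>\<^sub>w\<^sup>*)\<close>, which removes the term with index \<open>w\<close>. The
  \<open>\<epsilon>\<close> avoids improper integrals: it absorbs the boundary term \<open>|g(T) - f(T)|\<^sup>2\<close>.\<close>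
lemma exp_sum_point_evaluation:
  fixes \<mu> :: "'a \<Rightarrow> complex"
  assumes "finite S" "\<alpha> > 0" "\<And>j. j \<in> S \<Longrightarrow> Re (\<mu> j) = \<alpha> / 2" "\<epsilon> > 0"
  shows "\<forall>\<^sub>F T in at_top. (cmod (\<Sum>j\<in>S. a j))\<^sup>2 \<le> card S *
    (\<alpha> * integral {0..T} (\<lambda>t. (cmod (\<Sum>j\<in>S. a j * exp (- \<mu> j * complex_of_real t)))\<^sup>2) + \<epsilon>)"
  using assms
proof (induction S arbitrary: a \<epsilon> rule: finite_induct)
  case empty
  then show ?case by simp
next
  case (insert w S)
  \<comment> \<open>The Blaschke factor at s = -\<mu> j, times \<open>a j\<close>. It vanishes at
    \<open>j = w\<close>, so \<open>g\<close> runs over \<open>S\<close> only.\<close>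
  define b where "b j = a j * (\<mu> j - \<mu> w) / (\<mu> j + cnj (\<mu> w))" for j
  define f where "f t = (\<Sum>j\<in>insert w S. a j * exp (- \<mu> j * complex_of_real t))" for t
  define g where "g t = (\<Sum>j\<in>S. b j * exp (- \<mu> j * complex_of_real t))" for t
  define f' where "f' t = (\<Sum>j\<in>insert w S. - \<mu> j * a j * exp (- \<mu> j * complex_of_real t))" for t
  define g' where "g' t = (\<Sum>j\<in>S. - \<mu> j * b j * exp (- \<mu> j * complex_of_real t))" for t
  have Re: "Re (\<mu> j) = \<alpha> / 2" if "j \<in> insert w S" for j using insert.prems that by blast
  have f: "(f has_vector_derivative f' t) (at t)" and g: "(g has_vector_derivative g' t) (at t)" for t
    unfolding f_def f'_def g_def g'_def by (rule exp_sum_has_vector_derivative)+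
  have Re_pos: "Re (\<mu> j) > 0" if "j \<in> insert w S" for j using Re[OF that] \<open>\<alpha> > 0\<close> by simp
  have nz: "\<mu> j + cnj (\<mu> w) \<noteq> 0" if "j \<in> S" for j
    using Re[of j] Re[of w] that \<open>\<alpha> > 0\<close> by (auto simp: complex_eq_iff)
  have ode: "g' t - f' t = cnj (\<mu> w) * g t + \<mu> w * f t" for t
  proof -
    have "g' t - cnj (\<mu> w) * g t = (\<Sum>j\<in>S. - ((\<mu> j + cnj (\<mu> w)) * b j) * exp (- \<mu> j * complex_of_real t))"
      unfolding g_def g'_def by (simp add: sum_distrib_left algebra_simps flip: sum_subtractf sum_negf sum.distrib)
    also have "\<dots> = (\<Sum>j\<in>S. - (a j * (\<mu> j - \<mu> w)) * exp (- \<mu> j * complex_of_real t))"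
      using nz by (intro sum.cong) (auto simp: b_def)
    \<comment> \<open>In \<open>f' t + \<mu> w * f t\<close> the term of index \<open>w\<close> has
      coefficient \<open>(\<mu> w - \<mu> w) * a w = 0\<close>.\<close>
    also have "\<dots> = f' t + \<mu> w * f t"
      using insert.hyps unfolding f_def f'_def
      by (simp add: sum_distrib_left algebra_simps flip: sum_subtractf sum_negf sum.distrib)
    finally show ?thesis by (simp add: algebra_simps)
  qed
  have lim: "((\<lambda>t. (cmod (g t - f t))\<^sup>2) \<longlongrightarrow> (cmod (0 - 0))\<^sup>2) at_top"
    unfolding f_def g_def by (intro tendsto_intros exp_sum_tendsto_0 Re_pos) simp_all
  \<comment> \<open>Half of \<epsilon> covers the boundary term, the other half goes to the
    induction hypothesis.\<close>
  then have small: "\<forall>\<^sub>F T in at_top. (cmod (g T - f T))\<^sup>2 < \<epsilon> / 2"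
    using insert.prems by (intro order_tendstoD(2)[OF lim]) auto
  have IH: "\<forall>\<^sub>F T in at_top. (cmod (\<Sum>j\<in>S. b j))\<^sup>2 \<le> card S * (\<alpha> * integral {0..T} (\<lambda>t. (cmod (g t))\<^sup>2) + \<epsilon> / 2)"
    unfolding g_def using insert.prems by (intro insert.IH) auto
  have g0: "g 0 = (\<Sum>j\<in>S. b j)" and f0: "f 0 = (\<Sum>j\<in>insert w S. a j)"
    by (simp_all add: f_def g_def)
  show ?case
    using small IH eventually_ge_at_top[of 0]
  proof eventually_elim
    case (elim T)
    let ?G = "integral {0..T} (\<lambda>t. (cmod (g t))\<^sup>2)" and ?F = "integral {0..T} (\<lambda>t. (cmod (f t))\<^sup>2)"
    have cont: "continuous_on X g" for X
      using g by (meson has_vector_derivative_continuous continuous_at_imp_continuous_on)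
    have "?G \<ge> 0"
      by (intro Henstock_Kurzweil_Integration.integral_nonneg integrable_continuous_real continuous_intros cont) auto
    have "(cmod (g 0 - f 0))\<^sup>2 + \<alpha> * ?G = (cmod (g T - f T))\<^sup>2 + \<alpha> * ?F"
      using exp_integral_step[OF _ f g ode, of T] elim Re[of w] by simp
    then have "(cmod (f 0 - g 0))\<^sup>2 \<le> \<alpha> * ?F - \<alpha> * ?G + \<epsilon> / 2"
      using elim by (simp add: norm_minus_commute)
    \<comment> \<open>All exponents share the real part \<alpha>/2, so \<open>?G\<close> carries the
      same factor \<alpha> here as in the induction hypothesis and cancels in the sum.\<close>
    then have "(cmod (g 0 + (f 0 - g 0)))\<^sup>2 \<le> Suc (card S) * ((\<alpha> * ?G + \<epsilon> / 2) + (\<alpha> * ?F - \<alpha> * ?G + \<epsilon> / 2))"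
      using elim \<open>?G \<ge> 0\<close> \<open>\<alpha> > 0\<close> insert.prems by (intro norm_add_sq_le) (auto simp: g0)
    then show ?case
      unfolding f0[symmetric] f_def[symmetric] card_insert_disjoint[OF insert.hyps]
      by (simp add: algebra_simps)
  qed
qed

section \<open>The weighted integral beyond 1\<close>

text \<open>Sampled along a progression of step \<open>d\<close>, the sum becomes a power sum with
  nodes exp(i lam_j d) of modulus 1. Taking the l2 norm of the initial window as \<open>A\<close>
  gives a squared bound that can be integrated over \<open>x\<close> block by block.\<close>

lemma exp_sum_window_bound:
  fixes a :: "'a \<Rightarrow> complex" and lam :: "'a \<Rightarrow> real" and S :: "'a set" and n :: nat
  defines "f \<equiv> \<lambda>t. \<Sum>j\<in>S. a j * exp (\<i> * complex_of_real (lam j * t))"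
  assumes "finite S" "card S = n"
  shows "(cmod (f (x + real N * d)))\<^sup>2 \<le> 4 ^ (n + N) * (\<Sum>k<n. (cmod (f (x + real k * d)))\<^sup>2)"
proof -
  define A where "A = sqrt (\<Sum>k<n. (cmod (f (x + real k * d)))\<^sup>2)"
  define z where "z j = exp (\<i> * complex_of_real (lam j * d))" for j
  define b where "b j = a j * exp (\<i> * complex_of_real (lam j * x))" for j
  have fz: "f (x + real k * d) = (\<Sum>j\<in>S. b j * z j ^ k)" for k
    unfolding f_def b_def z_def
    by (intro sum.cong refl) (simp add: algebra_simps flip: exp_add exp_of_nat_mult)
  have z: "cmod (z j) = 1" for j by (simp add: z_def)
  have "A \<ge> 0" by (simp add: A_def sum_nonneg)
  have "cmod (f (x + real k * d)) \<le> A" if "k < n" for k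
    unfolding A_def using that by (intro real_le_rsqrt member_le_sum) auto
  then have "cmod (\<Sum>j\<in>S. b j * z j ^ N) \<le> A * 2 ^ (card S + N)"
    using assms by (intro power_sum_growth) (simp_all add: z \<open>A \<ge> 0\<close> flip: fz)
  then have "(cmod (f (x + real N * d)))\<^sup>2 \<le> (A * 2 ^ (n + N))\<^sup>2"
    using assms(3) by (simp add: fz power_mono)
  also have "\<dots> = A\<^sup>2 * 4 ^ (n + N)"
  proof -
    have "((2::real) ^ k)\<^sup>2 = 4 ^ k" for k
      by (simp add: power2_eq_square flip: power_mult_distrib)
    then show ?thesis by (simp only: power_mult_distrib)
  qed
  also have "A\<^sup>2 = (\<Sum>k<n. (cmod (f (x + real k * d)))\<^sup>2)"
    unfolding A_def by (intro real_sqrt_pow2 sum_nonneg) auto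
  finally show ?thesis by (simp add: mult.commute)
qed

text \<open>The right-hand side does not depend on \<open>M\<close>, so finite intervals made of
  whole blocks can stand in for the half line.\<close>

lemma exp_sum_weighted_integral_bound:
  fixes a :: "'a \<Rightarrow> complex" and lam :: "'a \<Rightarrow> real" and S :: "'a set" and n :: nat and \<gamma> :: real
  defines "f \<equiv> \<lambda>t. \<Sum>j\<in>S. a j * exp (\<i> * complex_of_real (lam j * t))"
  assumes S: "finite S" "card S = n" and n: "n \<ge> 1" and \<gamma>: "4 * exp (- \<gamma>) < 1"
    and M: "n \<le> M"
  shows "integral {0..real M / real n} (\<lambda>t. exp (- \<gamma> * real n * t) * (cmod (f t))\<^sup>2)
    \<le> (1 + (16 * exp (- \<gamma>)) ^ n / (1 - 4 * exp (- \<gamma>))) * integral {0..1} (\<lambda>t. (cmod (f t))\<^sup>2)"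
proof -
  define d where "d = 1 / real n"
  define F where "F t = (cmod (f t))\<^sup>2" for t
  define G where "G t = exp (- \<gamma> * real n * t) * F t" for t
  define B where "B N = integral {0..d} (\<lambda>x. F (x + real N * d))" for N
  define I where "I = integral {0..1} F"
  define q where "q = 4 * exp (- \<gamma>)"
  have \<gamma>0: "\<gamma> > 0"
  proof (rule ccontr)
    assume "\<not> \<gamma> > 0"
    then have "1 \<le> exp (- \<gamma>)" by simp
    with \<gamma> show False by linarith
  qed
  have q: "0 < q" "q < 1" using \<gamma> by (auto simp: q_def)
  have d: "d > 0" "real n * d = 1" using n by (auto simp: d_def)
  have contF: "continuous_on X F" for X
    unfolding F_def f_def by (intro continuous_intros)
  have contG: "continuous_on X G" for X
    unfolding G_def by (intro continuous_intros contF)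
  have contF': "continuous_on X (\<lambda>x. F (x + c))" and contG': "continuous_on X (\<lambda>x. G (x + c))" for X c
    by (intro continuous_on_compose2[OF contF[of UNIV]] continuous_on_compose2[OF contG[of UNIV]] continuous_intros; simp)+
  have F0: "F t \<ge> 0" for t by (simp add: F_def)
  have B0: "B N \<ge> 0" for N
    unfolding B_def by (intro Henstock_Kurzweil_Integration.integral_nonneg integrable_continuous_real contF' F0)
  have I: "I = (\<Sum>k<n. B k)"
    using integral_blocks[OF contF, of d n] d by (simp add: I_def B_def)
  have BI: "B N \<le> 4 ^ (n + N) * I" for N
  proof -
    have "B N \<le> integral {0..d} (\<lambda>x. 4 ^ (n + N) * (\<Sum>k<n. F (x + real k * d)))"
      unfolding B_def
      by (intro integral_le integrable_continuous_real continuous_intros contF')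
         (use exp_sum_window_bound[OF S, of a lam _ N d] in \<open>simp add: F_def f_def\<close>)
    also have "\<dots> = 4 ^ (n + N) * I"
      unfolding I B_def
      by (subst integral_mult_right, subst integral_sum) (auto intro!: integrable_continuous_real contF')
    finally show ?thesis .
  qed
  have GB: "integral {0..d} (\<lambda>x. G (x + real N * d)) \<le> exp (- \<gamma> * real N) * B N" for N
  proof -
    \<comment> \<open>Since \<open>n * d = 1\<close>, the weight on the \<open>N\<close>-th block is
      at most its value exp(-\<gamma> N) at the left end.\<close>
    have "G (x + real N * d) \<le> exp (- \<gamma> * real N) * F (x + real N * d)" if "x \<ge> 0" for x
    proof -
      have "real n * (x + real N * d) = real n * x + real N"
        using d by (simp add: algebra_simps)
      then have "real N \<le> real n * (x + real N * d)"
        using that by simp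
      then have "- \<gamma> * real n * (x + real N * d) \<le> - \<gamma> * real N"
        using \<gamma>0 by (simp add: mult.assoc)
      then show ?thesis unfolding G_def by (intro mult_right_mono F0) simp
    qed
    then have "integral {0..d} (\<lambda>x. G (x + real N * d)) \<le> integral {0..d} (\<lambda>x. exp (- \<gamma> * real N) * F (x + real N * d))"
      by (intro integral_le integrable_continuous_real continuous_intros contF' contG') auto
    then show ?thesis by (simp add: B_def)
  qed
  have exp4: "exp (- \<gamma> * real N) * 4 ^ N = q ^ N" for N
    by (simp add: q_def power_mult_distrib mult.commute flip: exp_of_nat_mult)
  have "integral {0..real M / real n} G = (\<Sum>N<M. integral {0..d} (\<lambda>x. G (x + real N * d)))"
    using integral_blocks[OF contG, of d M] d by (simp add: d_def)
  also have "\<dots> \<le> (\<Sum>N<M. exp (- \<gamma> * real N) * B N)"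
    by (intro sum_mono GB)
  also have "\<dots> = (\<Sum>N<n. exp (- \<gamma> * real N) * B N) + (\<Sum>N=n..<M. exp (- \<gamma> * real N) * B N)"
    using M by (simp add: sum.atLeastLessThan_concat lessThan_atLeast0)
  \<comment> \<open>The first \<open>n\<close> blocks tile [0,1], where weight at most 1 suffices;
    only later blocks use the growth bound.\<close>
  also have "\<dots> \<le> (\<Sum>N<n. 1 * B N) + (\<Sum>N=n..<M. exp (- \<gamma> * real N) * (4 ^ (n + N) * I))"
    using \<gamma>0 by (intro add_mono sum_mono mult_mono BI B0) auto
  also have "\<dots> = I + 4 ^ n * I * (\<Sum>N=n..<M. q ^ N)"
    unfolding exp4[symmetric] by (simp add: I sum_distrib_left power_add mult_ac)
  also have "(\<Sum>N=n..<M. q ^ N) = q ^ n * (\<Sum>k<M - n. q ^ k)"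
    using sum.shift_bounds_nat_ivl[of "\<lambda>k. q ^ k" 0 n "M - n"] M
    by (simp add: sum_distrib_left power_add lessThan_atLeast0 mult.commute)
  also have "I + 4 ^ n * I * (q ^ n * (\<Sum>k<M - n. q ^ k)) \<le> I + 4 ^ n * I * (q ^ n * (1 / (1 - q)))"
    using q B0 by (intro add_left_mono mult_left_mono)
      (auto simp: I sum_nonneg sum_gp_strict divide_simps)
  \<comment> \<open>The tail series starts at \<open>q ^ n\<close>; with the factor
    \<open>4 ^ n\<close> from the window bound the ratio becomes \<open>4 * q\<close>, that is 16
    exp(-\<gamma>).\<close>
  also have "\<dots> = (1 + (4 * q) ^ n / (1 - q)) * I"
    by (simp add: power_mult_distrib field_simps)
  finally show ?thesis by (simp add: G_def F_def I_def q_def cong: integral_cong)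
qed

section \<open>Choice of the weight and comparison of the constants\<close>

theorem theorem2p2:
  fixes \<gamma> :: real and n :: nat and f :: "real \<Rightarrow> complex"
  defines "\<gamma>\<^sub>0 \<equiv> 2 + ln 4"
  defines "\<delta> \<equiv> (\<gamma> - \<gamma>\<^sub>0) / 8"
  assumes "\<gamma>\<^sub>0 < \<gamma>" and "\<gamma> \<le> 4"
    and "n \<ge> 1" and "f \<in> exp_sums n"
  shows "cmod (f 0) \<le> sqrt \<gamma> * sqrt (1 + exp (- \<delta> * \<gamma> * real n) / \<delta>^2) * real n * L2_01_norm f"
proof -
  from \<open>f \<in> exp_sums n\<close> obtain a lam
    where f: "f = (\<lambda>t. \<Sum>j=1..n. a j * exp (\<i> * complex_of_real (lam j * t)))"
    unfolding exp_sums_def by (auto simp: fun_eq_iff simp del: of_real_mult)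
  define I where "I = integral {0..1} (\<lambda>t. (cmod (f t))\<^sup>2)"
  \<comment> \<open>Point evaluation costs the factor \<alpha> n, which is then \<gamma> n^2 as
    required.\<close>
  define \<alpha> where "\<alpha> = \<gamma> * real n"
  define \<mu> where "\<mu> j = complex_of_real (\<alpha> / 2) - \<i> * complex_of_real (lam j)" for j
  define h where "h t = (\<Sum>j=1..n. a j * exp (- \<mu> j * complex_of_real t))" for t
  define C where "C = 1 + exp (- \<delta> * \<gamma> * real n) / \<delta>\<^sup>2"
  have ln4: "ln (4::real) > 0" by simp
  have \<gamma>: "\<gamma> > 2"
    using \<open>\<gamma>\<^sub>0 < \<gamma>\<close> ln4 unfolding \<gamma>\<^sub>0_def by linarith
  have \<delta>8: "8 * \<delta> = \<gamma> - \<gamma>\<^sub>0" and "\<gamma>\<^sub>0 \<ge> 2"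
    using ln4 by (simp_all add: \<delta>_def \<gamma>\<^sub>0_def)
  then have \<delta>: "0 < \<delta>" "\<delta> \<le> 1 / 4"
    using \<open>\<gamma>\<^sub>0 < \<gamma>\<close> \<open>\<gamma> \<le> 4\<close> by simp_all
  have "\<alpha> > 0" using \<gamma> \<open>n \<ge> 1\<close> by (simp add: \<alpha>_def)
  have "continuous_on {0..1} (\<lambda>t. (cmod (f t))\<^sup>2)"
    unfolding f by (intro continuous_intros)
  then have I0: "I \<ge> 0"
    unfolding I_def by (intro Henstock_Kurzweil_Integration.integral_nonneg integrable_continuous_real) auto
  have "h t = exp (- complex_of_real (\<alpha> / 2 * t)) * f t" for t
    unfolding h_def f sum_distrib_left
    by (intro sum.cong refl) (simp add: \<mu>_def algebra_simps flip: exp_add)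
  then have h: "(cmod (h t))\<^sup>2 = exp (- \<gamma> * real n * t) * (cmod (f t))\<^sup>2" for t
    by (simp add: norm_mult power_mult_distrib \<alpha>_def power2_eq_square flip: exp_add)
  have e2: "exp (-2::real) \<le> 1 / 4"
  proof -
    have "(2::real)\<^sup>2 \<le> (exp 1)\<^sup>2" using exp_ge_add_one_self[of 1] by (intro power_mono) auto
    then show ?thesis by (simp add: exp_minus field_simps flip: exp_of_nat_mult)
  qed
  \<comment> \<open>Splits \<gamma> as 2 + ln 4 + 8 \<delta>; with e^2 at least 4 this gives 16
    exp(-\<gamma>) at most exp(-8 \<delta>).\<close>
  have "exp (- \<gamma>) = exp (-2) * exp (- ln 4) * exp (- (8 * \<delta>))"
    unfolding \<delta>8 by (simp add: \<gamma>\<^sub>0_def flip: exp_add)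
  then have e\<gamma>: "4 * exp (- \<gamma>) = exp (-2) * exp (- (8 * \<delta>))"
    by (simp add: exp_minus)
  then have e\<gamma>': "4 * exp (- \<gamma>) \<le> 1 / 4 * exp (- (8 * \<delta>))" "4 * exp (- \<gamma>) \<le> 1 / 4"
    using e2 mult_mono[OF e2, of "exp (- (8 * \<delta>))" 1] mult_right_mono[OF e2, of "exp (- (8 * \<delta>))"] \<delta> by auto
  \<comment> \<open>The denominator is at least 3/4; it is weakened to 1/16 because \<delta> \<le>
    1/4 makes 1/16 an upper bound for \<delta>^2.\<close>
  have "(16 * exp (- \<gamma>)) ^ n / (1 - 4 * exp (- \<gamma>)) \<le> exp (- (8 * \<delta>)) ^ n / (1 / 16)"
    using e\<gamma>' by (intro frac_le power_mono) auto
  also have "\<dots> \<le> exp (- \<delta> * \<gamma> * real n) / \<delta>\<^sup>2"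
  proof (rule frac_le)
    have "\<delta> * \<gamma> * real n \<le> \<delta> * 8 * real n"
      using \<delta> \<open>\<gamma> \<le> 4\<close> by (intro mult_right_mono mult_left_mono) auto
    then show "exp (- (8 * \<delta>)) ^ n \<le> exp (- \<delta> * \<gamma> * real n)"
      by (simp add: mult_ac flip: exp_of_nat_mult)
    show "\<delta>\<^sup>2 \<le> 1 / 16"
      using \<delta> power_mono[of \<delta> "1 / 4" 2] by (simp add: power2_eq_square)
  qed (use \<delta> in auto)
  finally have C: "1 + (16 * exp (- \<gamma>)) ^ n / (1 - 4 * exp (- \<gamma>)) \<le> C"
    by (simp add: C_def)
  have hI: "integral {0..real M / real n} (\<lambda>t. (cmod (h t))\<^sup>2) \<le> C * I" if "n \<le> M" for M
  proof -
    have "integral {0..real M / real n} (\<lambda>t. (cmod (h t))\<^sup>2)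
      \<le> (1 + (16 * exp (- \<gamma>)) ^ n / (1 - 4 * exp (- \<gamma>))) * I"
      unfolding h I_def f using e\<gamma>' that \<open>n \<ge> 1\<close> by (intro exp_sum_weighted_integral_bound) auto
    also have "\<dots> \<le> C * I" using C I0 by (rule mult_right_mono)
    finally show ?thesis .
  qed
  have lim: "filterlim (\<lambda>M. real M / real n) at_top sequentially"
    using \<open>n \<ge> 1\<close> by real_asymp
  have f0: "f 0 = (\<Sum>j=1..n. a j)" by (simp add: f)
  \<comment> \<open>Dividing by \<open>n\<close> leaves \<epsilon> isolated, ready to be sent to
    0.\<close>
  have "(cmod (f 0))\<^sup>2 / real n \<le> \<alpha> * (C * I) + \<epsilon>" if "\<epsilon> > 0" for \<epsilon>
  proof -
    have "\<forall>\<^sub>F T in at_top. (cmod (\<Sum>j=1..n. a j))\<^sup>2 \<le> card {1..n} *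
      (\<alpha> * integral {0..T} (\<lambda>t. (cmod (h t))\<^sup>2) + \<epsilon>)"
      unfolding h_def using \<open>\<alpha> > 0\<close> that by (intro exp_sum_point_evaluation) (auto simp: \<mu>_def)
    \<comment> \<open>The evaluation bound holds for all large \<open>T\<close>; it is read off at
      some \<open>T = M / n\<close> with \<open>n \<le> M\<close>, where \<open>hI\<close>
      applies.\<close>
    from eventually_conj[OF eventually_compose_filterlim[OF this lim] eventually_ge_at_top[of n]]
    obtain M where "n \<le> M"
      and M: "(cmod (f 0))\<^sup>2 \<le> real n * (\<alpha> * integral {0..real M / real n} (\<lambda>t. (cmod (h t))\<^sup>2) + \<epsilon>)"
      unfolding f0 by (auto simp: eventually_sequentially)
    note M
    also have "\<dots> \<le> real n * (\<alpha> * (C * I) + \<epsilon>)"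
      using hI[OF \<open>n \<le> M\<close>] \<open>\<alpha> > 0\<close> by (intro mult_left_mono add_right_mono) auto
    finally show ?thesis using \<open>n \<ge> 1\<close> by (simp add: field_simps)
  qed
  then have "(cmod (f 0))\<^sup>2 / real n \<le> \<alpha> * (C * I)"
    by (rule field_le_epsilon)
  then have "(cmod (f 0))\<^sup>2 \<le> \<gamma> * C * (real n)\<^sup>2 * I"
    using \<open>n \<ge> 1\<close> by (simp add: \<alpha>_def field_simps power2_eq_square)
  then have "cmod (f 0) \<le> sqrt (\<gamma> * C * (real n)\<^sup>2 * I)"
    by (rule real_le_rsqrt)
  then show ?thesis
    by (simp add: real_sqrt_mult C_def I_def L2_01_norm_def)
qed

end
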